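(* Let $R_1,R_2,R_3 \in \{3\} \cup \mathbb{Z}_{\geq 5}$. There is no Fano polygon with singularity content $\left(0, \left\{ \frac{1}{R_1}(1,1), \frac{1}{R_2}(1,1), \frac{1}{R_3}(1,1) \right\}\right)$.
   Context: Let $N \cong \mathbb{Z}^2$ and $N_{\mathbb{R}} = N \otimes \mathbb{R}$. A Fano polygon $P \subset N_{\mathbb{R}}$ is a full-dimensional (two-dimensional) convex lattice polygon whose vertices are all primitive lattice vectors and which contains the origin in its strict interior. Cyclic quotient singularities: for a positive integer $R$ and integers $a,b$ with $\gcd(R,a)=\gcd(R,b)=1$, $\frac{1}{R}(a,b)$ denotes the germ at the origin of the quotient of $\mathbb{C}^2$ by the cyclic group $\mu_R$ acting by $(x,y)\mapsto(\epsilon^a x,\epsilon^b y)$, $\epsilon$ a primitive $R$-th root of unity. Combinatorially it corresponds to the cone $\mathrm{cone}(e_1,e_2)$ in the lattice $\mathbb{Z}^2 + (a/R,b/R)\cdot\mathbb{Z}$. A two-dimensional rational cone $C \subset N_{\mathbb{R}}$ is identified with the singularity $\frac{1}{R}(a,b)$ if there is a lattice isomorphism taking $C$ to this cone (with $R=1$ for a smooth cone). Singularities are considered up to isomorphism. Singularity content of a cone: any cyclic quotient singularity $\sigma=\frac{1}{R}(a,b)$ can be written as $\frac{1}{kr}(1,kc-1)$ with $k=\gcd(a+b,R)$, $R=kr$, and some integer $c$. Let $n,k_0$ be the unique non-negative integers with $k=nr+k_0$, $0\le k_0<r$. The residue is $\mathrm{res}(\sigma)=\varnothing$ if $k_0=0$,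 and $\mathrm{res}(\sigma)=\frac{1}{k_0 r}(1,k_0c-1)$ otherwise. The singularity content of $\sigma$ is $\mathrm{SC}(\sigma)=(n,\mathrm{res}(\sigma))$. Singularity content of a polygon: let $E_1,\dots,E_m$ be the edges of the Fano polygon $P$ in clockwise order, let $\sigma_i$ be the singularity corresponding to the cone over $E_i$ (with apex the origin), and write $\mathrm{SC}(\sigma_i)=(n_i,\mathrm{res}(\sigma_i))$. The singularity content of $P$ is $\mathrm{SC}(P)=\left(\sum_{i=1}^m n_i,\mathcal{B}\right)$, where the basket of residual singularities $\mathcal{B}=\{\mathrm{res}(\sigma_1),\dots,\mathrm{res}(\sigma_m)\}$ is a cyclically ordered collection (counted with multiplicity, empty residues omitted). In the claim the $R_i$ are not assumed distinct. *)

theory Defs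
  imports "HOL-Analysis.Analysis"
begin

text \<open>The lattice \<open>N = \<int>\<^sup>2\<close> inside \<open>N\<^sub>\<real> = \<real>\<^sup>2\<close>.\<close>

definition latN :: "(real \<times> real) set" where
  "latN = \<int> \<times> \<int>"

definition primitive :: "real \<times> real \<Rightarrow> bool" where
  "primitive v \<longleftrightarrow> (\<exists>a b :: int. v = (of_int a, of_int b) \<and> coprime a b)"

definition fano_polygon :: "(real \<times> real) set \<Rightarrow> bool" where
  "fano_polygon P \<longleftrightarrow>
     polytope P \<and> aff_dim P = 2 \<and>
     (\<forall>v. v extreme_point_of P \<longrightarrow> primitive v) \<and>
     0 \<in> interior P"

text \<open>Isomorphism of pairs consisting of a lattice in the plane and a cone.\<close>

definition lattice_cone_iso ::
    "(real \<times> real) set \<Rightarrow> (real \<times> real) set \<Rightarrow> (real \<times> real) set \<Rightarrow> (real \<times> real) set \<Rightarrow> bool" where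
  "lattice_cone_iso L C L' C' \<longleftrightarrow>
     (\<exists>\<phi> :: real \<times> real \<Rightarrow> real \<times> real. linear \<phi> \<and> bij \<phi> \<and> \<phi> ` L = L' \<and> \<phi> ` C = C')"

text \<open>\<open>CQS R a b\<close> stands for the cyclic quotient singularity \<open>1/R (a, b)\<close>. It is a presentation:
  the singularities themselves are presentations satisfying \<open>cqs_valid\<close>, up to \<open>cqs_iso\<close>, that is,
  up to isomorphism of the associated toric data.\<close>

datatype cqs = CQS (cqs_order: nat) (cqs_wt1: int) (cqs_wt2: int)

definition cqs_valid :: "cqs \<Rightarrow> bool" where
  "cqs_valid \<sigma> \<longleftrightarrow> cqs_order \<sigma> > 0 \<and>
     coprime (int (cqs_order \<sigma>)) (cqs_wt1 \<sigma>) \<and> coprime (int (cqs_order \<sigma>)) (cqs_wt2 \<sigma>)"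

definition cqs_lattice :: "cqs \<Rightarrow> (real \<times> real) set" where
  "cqs_lattice \<sigma> =
     {(of_int i + of_int t * (of_int (cqs_wt1 \<sigma>) / of_nat (cqs_order \<sigma>)),
       of_int j + of_int t * (of_int (cqs_wt2 \<sigma>) / of_nat (cqs_order \<sigma>))) | i j t :: int. True}"

definition std_cone :: "(real \<times> real) set" where
  "std_cone = convex_cone hull {(1, 0), (0, 1)}"

definition cqs_iso :: "cqs \<Rightarrow> cqs \<Rightarrow> bool" where
  "cqs_iso \<sigma> \<tau> \<longleftrightarrow> lattice_cone_iso (cqs_lattice \<sigma>) std_cone (cqs_lattice \<tau>) std_cone"

definition cone_singularity :: "(real \<times> real) set \<Rightarrow> cqs \<Rightarrow> bool" where
  "cone_singularity C \<sigma> \<longleftrightarrow> cqs_valid \<sigma> \<and> lattice_cone_iso latN C (cqs_lattice \<sigma>) std_cone"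

text \<open>\<open>cqs_content \<sigma> n \<rho>\<close>: the singularity content of \<open>\<sigma>\<close> is \<open>(n, \<rho>)\<close>, where \<open>None\<close> is the empty
  residue. This is a relation because \<open>c\<close>, and hence the presentation of the residue, is not
  unique; the isomorphism class of the residue is.\<close>

definition cqs_content :: "cqs \<Rightarrow> nat \<Rightarrow> cqs option \<Rightarrow> bool" where
  "cqs_content \<sigma> n \<rho> \<longleftrightarrow>
     (\<exists>(k::nat) (r::nat) (c::int) (k0::nat).
        int k = gcd (cqs_wt1 \<sigma> + cqs_wt2 \<sigma>) (int (cqs_order \<sigma>)) \<and>
        cqs_order \<sigma> = k * r \<and>
        cqs_iso \<sigma> (CQS (k * r) 1 (int k * c - 1)) \<and>
        k = n * r + k0 \<and> k0 < r \<and>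
        \<rho> = (if k0 = 0 then None else Some (CQS (k0 * r) 1 (int k0 * c - 1))))"

text \<open>The edges are listed in clockwise order if the \<open>i\<close>-th one runs from \<open>vs ! i\<close> to the next
  vertex and the determinant of these two vectors is negative. The origin is meant to be an
  interior point of \<open>P\<close>.\<close>

definition clockwise_edges :: "(real \<times> real) set \<Rightarrow> (real \<times> real) set list \<Rightarrow> bool" where
  "clockwise_edges P Es \<longleftrightarrow>
     distinct Es \<and> set Es = {E. E edge_of P} \<and>
     (\<exists>vs :: (real \<times> real) list. length vs = length Es \<and>
        (\<forall>i < length Es. let v = vs ! i; w = vs ! (Suc i mod length Es) in
           Es ! i = closed_segment v w \<and> fst v * snd w - snd v * fst w < 0))"

text \<open>Equality of cyclically ordered collections of isomorphism classes of singularities.\<close>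

definition basket_eq :: "cqs list \<Rightarrow> cqs list \<Rightarrow> bool" where
  "basket_eq Bs Bs' \<longleftrightarrow> (\<exists>j. list_all2 cqs_iso (rotate j Bs) Bs')"

definition has_singularity_content :: "(real \<times> real) set \<Rightarrow> nat \<Rightarrow> cqs list \<Rightarrow> bool" where
  "has_singularity_content P n Bs \<longleftrightarrow>
     (\<exists>Es \<sigma>s ns \<rho>s.
        clockwise_edges P Es \<and>
        list_all2 (\<lambda>E \<sigma>. cone_singularity (convex_cone hull E) \<sigma>) Es \<sigma>s \<and>
        length ns = length Es \<and> length \<rho>s = length Es \<and>
        (\<forall>i < length Es. cqs_content (\<sigma>s ! i) (ns ! i) (\<rho>s ! i)) \<and>
        n = sum_list ns \<and>
        basket_eq (List.map_filter id \<rho>s) Bs)"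

end

theory Submission
  imports Defs
begin

text \<open>Content \<open>0\<close> forces every edge to contribute a nonempty residue isomorphic to its own cone, so
  \<open>P\<close> is a triangle with primitive vertices \<open>v\<^sub>1, v\<^sub>2, v\<^sub>3\<close> whose cones are of type \<open>1/R\<^sub>i (1, 1)\<close>.
  Such a cone means \<open>v\<^sub>i + v\<^sub>i\<^sub>+\<^sub>1 = R\<^sub>i u\<^sub>i\<close> with \<open>v\<^sub>i, u\<^sub>i\<close> a basis of the lattice. Expanding
  the determinant of \<open>v\<^sub>2, v\<^sub>3\<close> gives \<open>R\<^sub>2 = R\<^sub>1 + R\<^sub>3 - d R\<^sub>1 R\<^sub>3\<close> for an integer \<open>d\<close>, and \<open>d \<le> 0\<close> because
  \<open>R\<^sub>2 > 0\<close>. So \<open>R\<^sub>2 \<ge> R\<^sub>1 + R\<^sub>3\<close>, which is absurd together with its cyclic rotations.\<close>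

section \<open>Determinants and primitive lattice vectors\<close>

text \<open>The same expression as in \<open>clockwise_edges\<close>, so an edge listed as running
  from \<open>v\<close> to \<open>w\<close> has \<open>wedge v w < 0\<close>.\<close>

definition wedge :: "real \<times> real \<Rightarrow> real \<times> real \<Rightarrow> real" where
  "wedge v w = fst v * snd w - snd v * fst w"

lemma wedge_scaleR_right: "wedge v (c *\<^sub>R w) = c * wedge v w"
  by (simp add: wedge_def algebra_simps)

lemma wedge_in_Ints: "v \<in> latN \<Longrightarrow> w \<in> latN \<Longrightarrow> wedge v w \<in> \<int>"
  by (auto simp: latN_def wedge_def)

lemma primitive_in_latN: "primitive v \<Longrightarrow> v \<in> latN"
  by (auto simp: primitive_def latN_def)

text \<open>\<open>n\<close> divides both coordinates of \<open>v\<close>, which are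
  coprime.\<close>

lemma primitive_eq_scaleR_nat:
  assumes "primitive v" "v = real n *\<^sub>R x" "x \<in> latN"
  shows "n = 1"
proof -
  obtain a b where v: "v = (of_int a, of_int b)" "coprime a b"
    using assms(1) by (auto simp: primitive_def)
  obtain c d where x: "x = (of_int c, of_int d)"
    using assms(3) by (auto simp: latN_def elim!: Ints_cases)
  have "real_of_int a = of_int (int n * c)" "real_of_int b = of_int (int n * d)"
    using assms(2) v x by simp_all
  then have "a = int n * c" "b = int n * d"
    by (metis of_int_eq_iff)+
  then have "int n dvd 1"
    using v(2) by (metis coprime_common_divisor dvd_triv_left)
  then show ?thesis
    by simp
qed

section \<open>Cones over segments and the standard cone\<close>

lemma convex_cone_nonneg_combinations:
  fixes v w :: "'a::real_vector"
  shows "convex_cone {s *\<^sub>R v + t *\<^sub>R w | s t. 0 \<le> s \<and> 0 \<le> t}"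
proof -
  let ?S = "{s *\<^sub>R v + t *\<^sub>R w | s t. 0 \<le> s \<and> 0 \<le> t}"
  have "\<exists>s'' t''. (s *\<^sub>R v + t *\<^sub>R w) + (s' *\<^sub>R v + t' *\<^sub>R w) = s'' *\<^sub>R v + t'' *\<^sub>R w \<and> 0 \<le> s'' \<and> 0 \<le> t''"
    if "0 \<le> s" "0 \<le> t" "0 \<le> s'" "0 \<le> t'" for s t s' t' :: real
    using that by (intro exI[of _ "s + s'"] exI[of _ "t + t'"]) (simp add: algebra_simps)
  then have add: "x + y \<in> ?S" if "x \<in> ?S" "y \<in> ?S" for x y
    using that by blast
  have "\<exists>s'' t''. c *\<^sub>R (s *\<^sub>R v + t *\<^sub>R w) = s'' *\<^sub>R v + t'' *\<^sub>R w \<and> 0 \<le> s'' \<and> 0 \<le> t''"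
    if "0 \<le> c" "0 \<le> s" "0 \<le> t" for c s t :: real
    using that by (intro exI[of _ "c * s"] exI[of _ "c * t"]) (simp add: algebra_simps)
  then have scale: "c *\<^sub>R x \<in> ?S" if "0 \<le> c" "x \<in> ?S" for c x
    using that by blast
  have "0 \<in> ?S"
    by (auto intro!: exI[of _ 0])
  then show ?thesis
    unfolding convex_cone_iff by (intro conjI ballI allI impI add scale)
qed

lemma convex_cone_hull_closed_segment:
  fixes v w :: "'a::real_vector"
  shows "convex_cone hull (closed_segment v w) \<subseteq> {s *\<^sub>R v + t *\<^sub>R w | s t. 0 \<le> s \<and> 0 \<le> t}"
proof (rule hull_minimal)
  show "closed_segment v w \<subseteq> {s *\<^sub>R v + t *\<^sub>R w | s t. 0 \<le> s \<and> 0 \<le> t}"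
    by (force simp: closed_segment_def)
qed (rule convex_cone_nonneg_combinations)

text \<open>The two generators are the end points of a segment, so \<open>std_cone\<close> lies in
  the cone over that segment.\<close>

lemma std_cone_nonneg: "x \<in> std_cone \<Longrightarrow> 0 \<le> fst x \<and> 0 \<le> snd x"
proof -
  have "std_cone \<subseteq> convex_cone hull (closed_segment (1, 0) (0, 1))"
    unfolding std_cone_def by (intro hull_mono) simp
  then show "x \<in> std_cone \<Longrightarrow> ?thesis"
    using convex_cone_hull_closed_segment[of "(1::real, 0::real)" "(0, 1)"] by fastforce
qed

lemma std_cone_generators: "(1, 0) \<in> std_cone" "(0, 1) \<in> std_cone"
  by (auto simp: std_cone_def intro: hull_inc)

section \<open>Isomorphisms of cones and singularities of content 0\<close>

lemma lattice_cone_iso_trans: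
  assumes "lattice_cone_iso L C L' C'" "lattice_cone_iso L' C' L'' C''"
  shows "lattice_cone_iso L C L'' C''"
proof -
  obtain f g where "linear f" "bij f" "f ` L = L'" "f ` C = C'"
    "linear g" "bij g" "g ` L' = L''" "g ` C' = C''"
    using assms unfolding lattice_cone_iso_def by blast
  then show ?thesis
    unfolding lattice_cone_iso_def
    by (intro exI[of _ "g \<circ> f"]) (auto simp: linear_compose bij_comp image_comp[symmetric])
qed

text \<open>With \<open>n = 0\<close> the division reads \<open>k = k0\<close>, and
  \<open>k > 0\<close> because \<open>k * r\<close> is the order. The residue is then the normal
  form of \<open>\<sigma>\<close> itself.\<close>

lemma cqs_content_0:
  assumes "cqs_content \<sigma> 0 \<rho>" "cqs_valid \<sigma>"
  shows "\<exists>\<tau>. \<rho> = Some \<tau> \<and> cqs_iso \<sigma> \<tau>"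
  using assms by (auto simp: cqs_content_def cqs_valid_def)

section \<open>Cones of type 1/R (1, 1)\<close>

lemma cqs_lattice_11:
  "x \<in> cqs_lattice (CQS R 1 1) \<longleftrightarrow>
     (\<exists>i j t :: int. x = (of_int i + of_int t / real R, of_int j + of_int t / real R))"
  by (auto simp: cqs_lattice_def)

text \<open>Equal weights make the lattice symmetric. Composing with the swap therefore lets one
  choose which end point of an edge goes to which axis.\<close>

lemma cqs_lattice_11_swap:
  "prod.swap ` cqs_lattice (CQS R 1 1) = cqs_lattice (CQS R 1 1)"
proof -
  have "prod.swap x \<in> cqs_lattice (CQS R 1 1)" if "x \<in> cqs_lattice (CQS R 1 1)" for x
    using that unfolding cqs_lattice_11 by fastforce
  then show ?thesis
    by (metis image_subset_iff subset_antisym subsetI swap_swap rev_image_eqI)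
qed

lemma linear_swap: "linear (prod.swap :: 'a::real_vector \<times> 'b::real_vector \<Rightarrow> 'b \<times> 'a)"
  by (auto simp: linear_iff)

lemma std_cone_swap: "prod.swap ` std_cone = std_cone"
  unfolding std_cone_def
  by (subst convex_cone_hull_linear_image[symmetric]) (auto simp: linear_swap insert_commute)

text \<open>A generator of a ray of the cone is sent to a multiple of the generator of the image ray, and
  primitivity makes that multiple \<open>1\<close>.\<close>

lemma primitive_image_axis:
  assumes "linear \<phi>" "bij \<phi>" "\<phi> ` latN = cqs_lattice (CQS R 1 1)" "R > 0"
    and "primitive v" "\<phi> v = (a, 0)" "0 \<le> a"
  shows "\<phi> v = (1, 0)"
proof -
  have "(a, 0) \<in> cqs_lattice (CQS R 1 1)"
    using imageI[OF primitive_in_latN[OF assms(5)], of \<phi>] assms(3,6) by simp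
  then obtain i j t :: int where "a = of_int i + of_int t / real R" "0 = of_int j + of_int t / real R"
    by (auto simp: cqs_lattice_11)
  \<comment> \<open>The second coordinate gives \<open>t / R = - j\<close>, so lattice points on
    this axis are integer multiples of \<open>(1, 0)\<close>.\<close>
  then have "a = of_int (i - j)"
    by simp
  with \<open>0 \<le> a\<close> obtain n where n: "a = real n"
    by (metis of_int_0_le_iff of_int_of_nat_eq zero_le_imp_eq_int)
  have "(1, 0) \<in> cqs_lattice (CQS R 1 1)"
    unfolding cqs_lattice_11 by (intro exI[of _ 1] exI[of _ 0]) simp
  then obtain x where x: "x \<in> latN" "\<phi> x = (1, 0)"
    using assms(3) by (metis imageE)
  have "\<phi> (real n *\<^sub>R x) = \<phi> v"
    using assms(1,6) n x by (simp add: linear_cmul)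
  then have "v = real n *\<^sub>R x"
    using assms(2) by (metis bij_is_inj injD)
  then show ?thesis
    using primitive_eq_scaleR_nat[OF assms(5) _ x(1)] n assms(6) by simp
qed

text \<open>The axes are the extreme rays of the quadrant: when \<open>(1, 0)\<close> and
  \<open>(0, 1)\<close> are nonnegative combinations of two vectors of the quadrant, these vectors
  must lie on different axes.\<close>

lemma images_on_axes:
  assumes "linear \<phi>" "\<phi> ` (convex_cone hull (closed_segment v w)) = std_cone"
  shows "(snd (\<phi> v) = 0 \<and> fst (\<phi> w) = 0) \<or> (fst (\<phi> v) = 0 \<and> snd (\<phi> w) = 0)"
proof -
  have "v \<in> convex_cone hull (closed_segment v w)" "w \<in> convex_cone hull (closed_segment v w)"
    by (auto intro: hull_inc)
  then have nonneg: "0 \<le> fst (\<phi> v)" "0 \<le> snd (\<phi> v)" "0 \<le> fst (\<phi> w)" "0 \<le> snd (\<phi> w)"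
    using assms(2) std_cone_nonneg by blast+
  have comb: "\<exists>s t. 0 \<le> s \<and> 0 \<le> t \<and> y = s *\<^sub>R \<phi> v + t *\<^sub>R \<phi> w" if y: "y \<in> std_cone" for y
  proof -
    obtain x where x: "x \<in> convex_cone hull (closed_segment v w)" "\<phi> x = y"
      using y unfolding assms(2)[symmetric] by blast
    obtain s t where "0 \<le> s" "0 \<le> t" "x = s *\<^sub>R v + t *\<^sub>R w"
      using convex_cone_hull_closed_segment x(1) by blast
    then show ?thesis
      using x(2) assms(1) by (auto simp: linear_add linear_cmul)
  qed
  obtain s t where st: "0 \<le> s" "0 \<le> t" "(1, 0) = s *\<^sub>R \<phi> v + t *\<^sub>R \<phi> w"
    using comb std_cone_generators by blast
  obtain s' t' where st': "0 \<le> s'" "0 \<le> t'" "(0, 1) = s' *\<^sub>R \<phi> v + t' *\<^sub>R \<phi> w"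
    using comb std_cone_generators by blast
  have e: "1 = s * fst (\<phi> v) + t * fst (\<phi> w)" "0 = s * snd (\<phi> v) + t * snd (\<phi> w)"
    "0 = s' * fst (\<phi> v) + t' * fst (\<phi> w)" "1 = s' * snd (\<phi> v) + t' * snd (\<phi> w)"
    using st(3) st'(3) by (auto simp: prod_eq_iff)
  \<comment> \<open>A vanishing sum of nonnegative terms vanishes term by term.\<close>
  have z: "s * snd (\<phi> v) = 0" "t * snd (\<phi> w) = 0" "s' * fst (\<phi> v) = 0" "t' * fst (\<phi> w) = 0"
    using e(2,3) nonneg st(1,2) st'(1,2) by (metis add_nonneg_eq_0_iff mult_nonneg_nonneg)+
  show ?thesis
    using e(1,4) z by auto
qed

text \<open>The vector \<open>u\<close> is the preimage of \<open>(1/R, 1/R)\<close>. Together with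
  \<open>(1, 0)\<close>, the image of \<open>v\<close>, this point generates the lattice of 1/R (1,
  1), so \<open>v\<close> and \<open>u\<close> form a basis of \<open>latN\<close>.\<close>

lemma cone_11_basis:
  assumes "lattice_cone_iso latN (convex_cone hull (closed_segment v w)) (cqs_lattice (CQS R 1 1)) std_cone"
    and "R > 0" "primitive v" "primitive w"
    and neg: "wedge v w < 0"
  shows "\<exists>u \<in> latN. v + w = real R *\<^sub>R u \<and> wedge v u = -1"
proof -
  have "\<exists>\<phi>. linear \<phi> \<and> bij \<phi> \<and> \<phi> ` latN = cqs_lattice (CQS R 1 1) \<and>
      \<phi> ` (convex_cone hull (closed_segment v w)) = std_cone \<and> snd (\<phi> v) = 0 \<and> fst (\<phi> w) = 0"
  proof -
    obtain \<phi> where \<phi>: "linear \<phi>" "bij \<phi>" "\<phi> ` latN = cqs_lattice (CQS R 1 1)"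
        "\<phi> ` (convex_cone hull (closed_segment v w)) = std_cone"
      using assms(1) by (auto simp: lattice_cone_iso_def)
    have swap: "linear (prod.swap \<circ> \<phi>)" "bij (prod.swap \<circ> \<phi>)"
        "(prod.swap \<circ> \<phi>) ` latN = cqs_lattice (CQS R 1 1)"
        "(prod.swap \<circ> \<phi>) ` (convex_cone hull (closed_segment v w)) = std_cone"
      using \<phi> linear_compose[OF \<phi>(1) linear_swap]
      by (simp_all only: bij_comp bij_swap image_comp[symmetric] cqs_lattice_11_swap std_cone_swap)
    from images_on_axes[OF \<phi>(1,4)] show ?thesis
    proof
      assume "snd (\<phi> v) = 0 \<and> fst (\<phi> w) = 0"
      with \<phi> show ?thesis by blast
    next
      assume "fst (\<phi> v) = 0 \<and> snd (\<phi> w) = 0"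
      with swap show ?thesis by (intro exI[of _ "prod.swap \<circ> \<phi>"]) simp
    qed
  qed
  then obtain \<phi> where \<phi>: "linear \<phi>" "bij \<phi>" "\<phi> ` latN = cqs_lattice (CQS R 1 1)"
      "\<phi> ` (convex_cone hull (closed_segment v w)) = std_cone" "snd (\<phi> v) = 0" "fst (\<phi> w) = 0"
    by blast
  have inj: "x = y" if "\<phi> x = \<phi> y" for x y
    using \<phi>(2) that by (metis bij_is_inj injD)
  have "\<phi> v \<in> std_cone" "\<phi> w \<in> std_cone"
    using \<phi>(4) by (blast intro: hull_inc ends_in_segment)+
  then have nn: "0 \<le> fst (\<phi> v)" "0 \<le> snd (\<phi> w)"
    using std_cone_nonneg by blast+
  have v: "\<phi> v = (1, 0)"
    using primitive_image_axis[OF \<phi>(1-3) assms(2,3), of "fst (\<phi> v)"] nn \<phi>(5)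
    by (metis prod.collapse)
  have "(prod.swap \<circ> \<phi>) ` latN = cqs_lattice (CQS R 1 1)"
    by (simp only: image_comp[symmetric] \<phi>(3) cqs_lattice_11_swap)
  moreover have "(prod.swap \<circ> \<phi>) w = (snd (\<phi> w), 0)"
    using \<phi>(6) by (simp add: prod_eq_iff)
  ultimately have "(prod.swap \<circ> \<phi>) w = (1, 0)"
    using primitive_image_axis[OF linear_compose[OF \<phi>(1) linear_swap]] \<phi>(2) assms(2,4) nn(2)
    by (metis bij_comp bij_swap)
  then have w: "\<phi> w = (0, 1)"
    by (simp add: prod_eq_iff)
  have "(1 / real R, 1 / real R) \<in> cqs_lattice (CQS R 1 1)"
    unfolding cqs_lattice_11 by (intro exI[of _ 0] exI[of _ 1]) simp
  then obtain u where u: "u \<in> latN" "\<phi> u = (1 / real R, 1 / real R)"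
    using \<phi>(3) by (metis imageE)
  have "\<phi> (v + w) = \<phi> (real R *\<^sub>R u)"
    using \<phi>(1) v w u \<open>R > 0\<close> by (simp add: linear_add linear_cmul)
  then have vw: "v + w = real R *\<^sub>R u"
    by (rule inj)
  have basis: "\<exists>m n :: int. x = of_int m *\<^sub>R v + of_int n *\<^sub>R u" if "x \<in> latN" for x
  proof -
    obtain i j t :: int where "\<phi> x = (of_int i + of_int t / real R, of_int j + of_int t / real R)"
      using \<phi>(3) \<open>x \<in> latN\<close> cqs_lattice_11 by blast
    \<comment> \<open>The coefficient of \<open>u\<close> is \<open>R\<close> times the second
      coordinate of \<open>\<phi> x\<close>; the rest is a multiple of
      \<open>(1, 0)\<close>.\<close>
    then have "\<phi> x = \<phi> (of_int (i - j) *\<^sub>R v + of_int (int R * j + t) *\<^sub>R u)"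
      using v u(2) \<open>R > 0\<close> by (simp add: linear_add[OF \<phi>(1)] linear_cmul[OF \<phi>(1)]
          linear_diff[OF \<phi>(1)] field_simps)
    then show ?thesis
      using inj by blast
  qed
  have "(1, 0) \<in> latN" "(0, 1) \<in> latN"
    by (auto simp: latN_def)
  then obtain a b c d :: int where
      e: "(1, 0) = of_int a *\<^sub>R v + of_int b *\<^sub>R u" "(0, 1) = of_int c *\<^sub>R v + of_int d *\<^sub>R u"
    using basis by meson
  obtain z where z: "wedge v u = of_int z"
    using wedge_in_Ints[OF primitive_in_latN[OF assms(3)] u(1)] by (auto elim: Ints_cases)
  \<comment> \<open>Expanding the standard basis in \<open>v\<close> and \<open>u\<close> makes 1
    the product of an integer determinant with \<open>z\<close>, so \<open>z\<close> is a
    unit.\<close>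
  have "1 = wedge (1, 0) (0, 1)"
    by (simp add: wedge_def)
  also have "\<dots> = of_int ((a * d - b * c) * z)"
    unfolding e by (simp add: z[symmetric]) (simp add: wedge_def algebra_simps)
  finally have "(a * d - b * c) * z = 1"
    by (metis of_int_eq_1_iff)
  then have "z = 1 \<or> z = -1"
    by (metis mult.commute zmult_eq_1_iff)
  \<comment> \<open>The orientation selects the sign:
    \<open>R * wedge v u = wedge v (v + w) = wedge v w\<close>.\<close>
  moreover have "real R * wedge v u < 0"
    using neg wedge_scaleR_right[of v "real R" u] by (simp flip: vw) (simp add: wedge_def algebra_simps)
  then have "z < 0"
    using z by (simp add: mult_less_0_iff)
  ultimately show ?thesis
    using u(1) vw z by auto
qed

section \<open>Arithmetic of three 1/R (1, 1) cones around the origin\<close>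

text \<open>Here \<open>v1\<close> is the vertex shared by the cones of orders \<open>R1\<close> and
  \<open>R3\<close>. Eliminating \<open>v2\<close> and \<open>v3\<close> through \<open>v1\<close>
  leaves the integer \<open>wedge u1 u3\<close> as the only unknown in \<open>wedge v2 v3\<close>,
  and negativity of the latter bounds it.\<close>

lemma opposite_index_ge:
  assumes "u1 \<in> latN" "u3 \<in> latN"
    and u1: "v1 + v2 = real R1 *\<^sub>R u1" "wedge v1 u1 = -1"
    and u3: "v3 + v1 = real R3 *\<^sub>R u3" "wedge v3 u3 = -1"
    and neg: "wedge v2 v3 < 0"
    and R: "R1 \<ge> 2" "R3 \<ge> 2"
  shows "real R1 + real R3 \<le> - wedge v2 v3"
proof -
  have v2: "v2 = real R1 *\<^sub>R u1 - v1" and v3: "v3 = real R3 *\<^sub>R u3 - v1"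
    using u1(1) u3(1) by (metis add_diff_cancel_left' add_diff_cancel_right')+
  have "wedge v1 u3 = 1"
    using u3(2) by (simp add: v3 wedge_def algebra_simps)
  moreover have "wedge v2 v3 = real R1 * real R3 * wedge u1 u3 + real R1 * wedge v1 u1 - real R3 * wedge v1 u3"
    by (simp add: v2 v3 wedge_def algebra_simps)
  ultimately have eq: "wedge v2 v3 = real R1 * real R3 * wedge u1 u3 - real R1 - real R3"
    using u1(2) by simp
  obtain d where d: "wedge u1 u3 = of_int d"
    using wedge_in_Ints[OF assms(1,2)] by (auto elim: Ints_cases)
  have "d \<le> 0"
  proof (rule ccontr)
    assume "\<not> d \<le> 0"
    then have "real R1 * real R3 * 1 \<le> real R1 * real R3 * of_int d"
      by (intro mult_left_mono) auto
    then have "real R1 * real R3 < real R1 + real R3"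
      using eq[unfolded d] neg by linarith
    \<comment> \<open>Hence \<open>R1 * R3 \<ge> 2 * (R1 + R3) - 4 \<ge> R1 + R3\<close>, the last
      step by \<open>R1 + R3 \<ge> 4\<close>; this contradicts the strict inequality above.\<close>
    moreover have "0 \<le> (real R1 - 2) * (real R3 - 2)"
      using R by simp
    ultimately show False
      using R by (simp add: algebra_simps)
  qed
  then have "real R1 * real R3 * of_int d \<le> 0"
    by (simp add: mult_nonneg_nonpos)
  then show ?thesis
    using eq d by simp
qed

text \<open>The inequalities around \<open>v1\<close> and around \<open>v2\<close> add up to
  \<open>2 * R1 \<le> 0\<close>.\<close>

lemma no_triangle_11:
  assumes "R1 \<ge> 2" "R2 \<ge> 2" "R3 \<ge> 2"
    and "u1 \<in> latN" "v1 + v2 = real R1 *\<^sub>R u1" "wedge v1 u1 = -1" "wedge v1 v2 < 0"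
    and "u2 \<in> latN" "v2 + v3 = real R2 *\<^sub>R u2" "wedge v2 u2 = -1" "wedge v2 v3 < 0"
    and "u3 \<in> latN" "v3 + v1 = real R3 *\<^sub>R u3" "wedge v3 u3 = -1" "wedge v3 v1 < 0"
  shows False
proof -
  \<comment> \<open>This identifies \<open>- wedge v2 v3\<close> in \<open>opposite_index_ge\<close>
    with the order of the opposite cone.\<close>
  have sum: "wedge v w = - real R" if "v + w = real R *\<^sub>R u" "wedge v u = -1" for v w u R
  proof -
    have "wedge v (v + w) = - real R"
      using that by (simp add: wedge_scaleR_right)
    then show ?thesis
      by (simp add: wedge_def algebra_simps)
  qed
  have "real R1 + real R3 \<le> real R2"
    using opposite_index_ge[of u1 u3 v1 v2 R1 v3 R3] sum assms by simp
  moreover have "real R2 + real R1 \<le> real R3"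
    using opposite_index_ge[of u2 u1 v2 v3 R2 v1 R1] sum assms by simp
  ultimately show False
    using assms(1) by simp
qed

section \<open>Edges of a polygon with content 0\<close>

text \<open>End points of a segment are extreme in it, and extreme points of a face are extreme in
  the whole polytope.\<close>

lemma edge_endpoints_primitive:
  assumes "fano_polygon P" "closed_segment v w edge_of P"
  shows "primitive v" "primitive w"
proof -
  have "closed_segment v w face_of P"
    using assms(2) by (simp add: edge_of_def)
  then have "v extreme_point_of P" "w extreme_point_of P"
    by (metis extreme_point_of_face extreme_point_of_segment)+
  then show "primitive v" "primitive w"
    using assms(1) unfolding fano_polygon_def by blast+
qed

text \<open>Naturals with sum 0 all vanish, so by \<open>cqs_content_0\<close> every edge leaves a
  residue isomorphic to its own cone. The cyclic matching of edges with basket entries is weakened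
  to membership.\<close>

lemma content_0_edges:
  assumes "has_singularity_content P 0 Bs"
  obtains Es where "clockwise_edges P Es" "length Es = length Bs"
    "\<And>E. E \<in> set Es \<Longrightarrow>
       \<exists>\<tau> \<in> set Bs. lattice_cone_iso latN (convex_cone hull E) (cqs_lattice \<tau>) std_cone"
proof -
  obtain Es \<sigma>s ns \<rho>s j where Es: "clockwise_edges P Es"
    and \<sigma>s: "list_all2 (\<lambda>E \<sigma>. cone_singularity (convex_cone hull E) \<sigma>) Es \<sigma>s"
    and len: "length ns = length Es" "length \<rho>s = length Es"
    and content: "\<And>i. i < length Es \<Longrightarrow> cqs_content (\<sigma>s ! i) (ns ! i) (\<rho>s ! i)"
    and "0 = sum_list ns"
    and j: "list_all2 cqs_iso (rotate j (List.map_filter id \<rho>s)) Bs"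
    using assms unfolding has_singularity_content_def basket_eq_def by metis
  have ns: "ns ! i = 0" if "i < length Es" for i
    using \<open>0 = sum_list ns\<close> len(1) that by simp
  have res: "\<exists>\<tau>. \<rho>s ! i = Some \<tau> \<and>
      lattice_cone_iso latN (convex_cone hull (Es ! i)) (cqs_lattice \<tau>) std_cone"
    if i: "i < length Es" for i
  proof -
    have \<sigma>: "cone_singularity (convex_cone hull (Es ! i)) (\<sigma>s ! i)"
      using \<sigma>s i by (simp add: list_all2_conv_all_nth)
    then obtain \<tau> where "\<rho>s ! i = Some \<tau>" "cqs_iso (\<sigma>s ! i) \<tau>"
      using cqs_content_0 content[OF i] ns[OF i] unfolding cone_singularity_def by metis
    with \<sigma> show ?thesis
      unfolding cone_singularity_def cqs_iso_def by (blast intro: lattice_cone_iso_trans)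
  qed
  \<comment> \<open>No residue is empty, so the filter drops nothing and the basket has exactly one
    entry per edge.\<close>
  have "\<forall>\<rho> \<in> set \<rho>s. \<rho> \<noteq> None"
    using res len by (metis in_set_conv_nth option.distinct(1))
  then have mf: "List.map_filter id \<rho>s = map the \<rho>s"
    by (induction \<rho>s) auto
  show thesis
  proof (rule that[OF Es])
    show "length Es = length Bs"
      using list_all2_lengthD[OF j] mf len by simp
    fix E assume "E \<in> set Es"
    then obtain i where i: "i < length Es" "E = Es ! i"
      by (metis in_set_conv_nth)
    obtain \<tau> where \<tau>: "\<rho>s ! i = Some \<tau>"
        "lattice_cone_iso latN (convex_cone hull E) (cqs_lattice \<tau>) std_cone"
      using res[OF i(1)] i(2) by blast
    have "\<tau> \<in> set (rotate j (List.map_filter id \<rho>s))"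
      using mf \<tau>(1) i(1) len(2) by (metis image_eqI list.set_map nth_mem option.sel set_rotate)
    then obtain \<tau>' where "\<tau>' \<in> set Bs" "cqs_iso \<tau> \<tau>'"
      using j by (metis in_set_conv_nth list_all2_conv_all_nth)
    with \<tau>(2) show "\<exists>\<tau> \<in> set Bs. lattice_cone_iso latN (convex_cone hull E) (cqs_lattice \<tau>) std_cone"
      unfolding cqs_iso_def by (blast intro: lattice_cone_iso_trans)
  qed
qed

section \<open>Contradiction for a polygon with three edges\<close>

theorem theorem1p8:
  fixes R1 R2 R3 :: nat
  assumes "R1 \<in> {3} \<union> {5..}" and "R2 \<in> {3} \<union> {5..}" and "R3 \<in> {3} \<union> {5..}"
  shows "\<not> (\<exists>P. fano_polygon P \<and>
           has_singularity_content P 0 [CQS R1 1 1, CQS R2 1 1, CQS R3 1 1])"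
proof
  assume "\<exists>P. fano_polygon P \<and> has_singularity_content P 0 [CQS R1 1 1, CQS R2 1 1, CQS R3 1 1]"
  then obtain P where P: "fano_polygon P"
    "has_singularity_content P 0 [CQS R1 1 1, CQS R2 1 1, CQS R3 1 1]"
    by blast
  obtain Es where Es: "clockwise_edges P Es" "length Es = 3"
    "\<And>E. E \<in> set Es \<Longrightarrow> \<exists>\<tau> \<in> set [CQS R1 1 1, CQS R2 1 1, CQS R3 1 1].
       lattice_cone_iso latN (convex_cone hull E) (cqs_lattice \<tau>) std_cone"
    by (rule content_0_edges[OF P(2)]) auto
  obtain vs :: "(real \<times> real) list" where
    vs: "\<And>i. i < 3 \<Longrightarrow> Es ! i = closed_segment (vs ! i) (vs ! (Suc i mod 3)) \<and>
                      wedge (vs ! i) (vs ! (Suc i mod 3)) < 0"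
    using Es(1,2) unfolding clockwise_edges_def wedge_def Let_def by metis
  \<comment> \<open>Which of \<open>R1\<close>, \<open>R2\<close>, \<open>R3\<close> belongs to the
    edge is left open; only the bound 2 is kept, as \<open>no_triangle_11\<close> holds for any such
    orders.\<close>
  have basis: "\<exists>R\<ge>2. \<exists>u \<in> latN. vs ! i + vs ! (Suc i mod 3) = real R *\<^sub>R u \<and> wedge (vs ! i) u = -1"
    if i: "i < 3" for i
  proof -
    have "Es ! i \<in> set Es"
      using i Es(2) by simp
    then obtain \<tau> where "\<tau> \<in> set [CQS R1 1 1, CQS R2 1 1, CQS R3 1 1]"
        "lattice_cone_iso latN (convex_cone hull (Es ! i)) (cqs_lattice \<tau>) std_cone"
      using Es(3) by blast
    moreover from this(1) obtain R where "\<tau> = CQS R 1 1" "R \<ge> 2"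
      using assms by (elim UnE; simp) fastforce+
    moreover have "Es ! i edge_of P"
      using \<open>Es ! i \<in> set Es\<close> Es(1) by (auto simp: clockwise_edges_def)
    ultimately show ?thesis
      using cone_11_basis vs[OF i] edge_endpoints_primitive[OF P(1)]
      by (metis le_zero_eq not_gr_zero zero_neq_numeral)
  qed
  \<comment> \<open>\<open>A\<close>, \<open>B\<close> and \<open>C\<close> are the orders met in
    clockwise order along the triangle; no assignment to \<open>R1\<close>, \<open>R2\<close>,
    \<open>R3\<close> is claimed.\<close>
  obtain A u1 where 1: "A \<ge> 2" "u1 \<in> latN" "vs ! 0 + vs ! 1 = real A *\<^sub>R u1" "wedge (vs ! 0) u1 = -1"
    using basis[of 0] by auto
  obtain B u2 where 2: "B \<ge> 2" "u2 \<in> latN" "vs ! 1 + vs ! 2 = real B *\<^sub>R u2" "wedge (vs ! 1) u2 = -1"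
    using basis[of 1] by (auto simp: numeral_2_eq_2)
  obtain C u3 where 3: "C \<ge> 2" "u3 \<in> latN" "vs ! 2 + vs ! 0 = real C *\<^sub>R u3" "wedge (vs ! 2) u3 = -1"
    using basis[of 2] by auto
  have "wedge (vs ! 0) (vs ! 1) < 0" "wedge (vs ! 1) (vs ! 2) < 0" "wedge (vs ! 2) (vs ! 0) < 0"
    using vs[of 0] vs[of 1] vs[of 2] by (simp_all add: numeral_2_eq_2)
  with 1 2 3 show False
    by (intro no_triangle_11[of A B C u1 "vs ! 0" "vs ! 1" u2 "vs ! 2" u3])
qed

end
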